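(* Let $\sigma\in\mathbb R$ and let $V:\mathbb R\to\mathbb R$ be smooth. For any smooth function $u(x,s)$ of $x\in\mathbb R$ and of a real parameter $s$, set $$L=u_xu_{xxx}+\tfrac12u_{xx}^2+\tfrac12\sigma u_x^2-V(u),\qquad A(x,s)=u_{xxx}u_s+u_xu_{xxs}+\sigma u_xu_s .$$ Then $$L_s+u_s\big(u_{xxxx}+\sigma u_{xx}+V'(u)\big)=A_x .$$ In particular, if for each $s$ the function $u(\cdot,s)$ solves $u_{xxxx}+\sigma u_{xx}+V'(u)=0$, then $L_s=A_x$; and if moreover $u$ is periodic in $s$ (so that $s\in S^1$), then $$\frac{d}{dx}\oint_{S^1}\big(u_{xxx}u_s+u_xu_{xxs}+\sigma u_xu_s\big)\,ds=0 .$$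
   Context: $L$ is the Lagrangian density of the ODE $u_{xxxx}+\sigma u_{xx}+V'(u)=0$, and $A(x,s)$ is called the action density of the ensemble $u(x,s)$ of functions parameterized by $s$. Subscripts denote partial derivatives. *)

theory Defs
  imports "HOL-Analysis.Analysis"
begin

text \<open>
  \<open>C_k_fun k f\<close>: \<open>f\<close> is of class \<open>C\<^sup>k\<close> on the whole space. Asking every directional derivative
  to be of class \<open>C\<^sup>k\<close> (in the step to \<open>Suc k\<close>) is the usual notion when the domain is finite-dimensional,
  which is the only case in which it is used.
\<close>

primrec C_k_fun :: "nat \<Rightarrow> ('a::real_normed_vector \<Rightarrow> 'b::real_normed_vector) \<Rightarrow> bool" where
  "C_k_fun 0 f \<longleftrightarrow> continuous_on UNIV f"
| "C_k_fun (Suc k) f \<longleftrightarrow>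
     (\<forall>x. f differentiable (at x)) \<and> (\<forall>v. C_k_fun k (\<lambda>x. frechet_derivative f (at x) v))"

definition smooth_fun :: "('a::real_normed_vector \<Rightarrow> 'b::real_normed_vector) \<Rightarrow> bool" where
  "smooth_fun f \<longleftrightarrow> (\<forall>k. C_k_fun k f)"

definition pdx :: "(real \<Rightarrow> real \<Rightarrow> real) \<Rightarrow> real \<Rightarrow> real \<Rightarrow> real" where
  "pdx u x s = deriv (\<lambda>y. u y s) x"

definition pds :: "(real \<Rightarrow> real \<Rightarrow> real) \<Rightarrow> real \<Rightarrow> real \<Rightarrow> real" where
  "pds u x s = deriv (\<lambda>t. u x t) s"

definition solves_ode4 :: "real \<Rightarrow> (real \<Rightarrow> real) \<Rightarrow> (real \<Rightarrow> real) \<Rightarrow> bool" where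
  "solves_ode4 \<sigma> V w \<longleftrightarrow>
     (\<forall>x. (deriv ^^ 4) w x + \<sigma> * (deriv ^^ 2) w x + deriv V (w x) = 0)"

definition lagrangian :: "real \<Rightarrow> (real \<Rightarrow> real) \<Rightarrow> (real \<Rightarrow> real \<Rightarrow> real) \<Rightarrow> real \<Rightarrow> real \<Rightarrow> real" where
  "lagrangian \<sigma> V u x s =
     pdx u x s * (pdx ^^ 3) u x s + 1/2 * ((pdx ^^ 2) u x s)\<^sup>2 + 1/2 * \<sigma> * (pdx u x s)\<^sup>2 - V (u x s)"

definition action_density :: "real \<Rightarrow> (real \<Rightarrow> real \<Rightarrow> real) \<Rightarrow> real \<Rightarrow> real \<Rightarrow> real" where
  "action_density \<sigma> u x s =
     (pdx ^^ 3) u x s * pds u x s + pdx u x s * pds ((pdx ^^ 2) u) x s + \<sigma> * pdx u x s * pds u x s"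

end

theory Submission
  imports Defs
begin

text \<open>
  Everything rests on two facts about a smooth \<open>u\<close>: the partial derivatives of all orders exist and are
  continuous, and the two operators \<open>pdx\<close> and \<open>pds\<close> commute. The first holds because partial
  derivatives are Frechet derivatives in coordinate directions, and directional derivatives of a
  smooth function are smooth (\<open>smooth_fun_pdx\<close>, \<open>smooth_fun_pds\<close>); the second is \<open>pdx_pds_commute\<close>.

  Given these, the product rule yields
  \[ A_x = u_{xxxx} u_s + u_{xxx} u_{xs} + u_{xx} u_{xxs} + u_x u_{xxxs}
     + \sigma (u_{xx} u_s + u_x u_{xs}), \]
  while the chain rule yields
  \[ L_s = u_{xs} u_{xxx} + u_x u_{xxxs} + u_{xx} u_{xxs} + \sigma u_x u_{xs} - V'(u) u_s. \]
  The difference \<open>A\<^sub>x - L\<^sub>s\<close> is \<open>u\<^sub>s\<close> times the left-hand side of the equation.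

  For a family of solutions this leaves \<open>A\<^sub>x = L\<^sub>s\<close>, with \<open>A\<^sub>x\<close> continuous. Differentiation under the
  integral sign turns the derivative of \<open>\<integral> A ds\<close> into \<open>\<integral> L\<^sub>s ds\<close>, which is the increment of \<open>L\<close> over one
  period. It vanishes because \<open>L\<close>, being built from \<open>u\<close> and its \<open>x\<close>-derivatives at a single \<open>s\<close>,
  inherits the period of \<open>u\<close>.
\<close>

section \<open>Smooth functions of two real variables\<close>

lemma smooth_fun_differentiable:
  assumes "smooth_fun f"
  shows "f differentiable (at x)"
proof -
  have "C_k_fun (Suc 0) f"
    using assms unfolding smooth_fun_def by blast
  then show ?thesis by simp
qed

lemma smooth_fun_has_deriv:
  fixes f :: "real \<Rightarrow> real"
  assumes "smooth_fun f"
  shows "(f has_real_derivative deriv f x) (at x)"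
  using smooth_fun_differentiable[OF assms] DERIV_deriv_iff_real_differentiable by metis

lemma smooth_fun_continuous:
  assumes "smooth_fun f"
  shows "continuous_on S f"
proof -
  have "C_k_fun 0 f"
    using assms unfolding smooth_fun_def by blast
  then show ?thesis
    using continuous_on_subset by auto
qed

lemma smooth_fun_directional:
  assumes "smooth_fun f"
  shows "smooth_fun (\<lambda>x. frechet_derivative f (at x) v)"
  unfolding smooth_fun_def
proof
  fix k
  have "C_k_fun (Suc k) f"
    using assms unfolding smooth_fun_def by blast
  then show "C_k_fun k (\<lambda>x. frechet_derivative f (at x) v)" by simp
qed

lemma partial_x_frechet:
  fixes v :: "real \<Rightarrow> real \<Rightarrow> real"
  assumes "smooth_fun (\<lambda>(x, s). v x s)"
  shows "((\<lambda>y. v y s) has_real_derivative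
           frechet_derivative (\<lambda>(x, s). v x s) (at (x, s)) (1, 0)) (at x)"
proof -
  let ?f = "\<lambda>(x, s). v x s"
  let ?D = "frechet_derivative ?f (at (x, s))"
  have D: "(?f has_derivative ?D) (at (x, s))"
    using smooth_fun_differentiable[OF assms] frechet_derivative_works by blast
  have "((\<lambda>y. (y, s)) has_vector_derivative (1, 0)) (at x)"
    unfolding has_vector_derivative_def
    by (auto intro!: derivative_eq_intros)
  from vector_derivative_diff_chain_within[OF this has_derivative_at_withinI[OF D]]
  show ?thesis
    by (simp add: o_def has_real_derivative_iff_has_vector_derivative)
qed

lemma partial_s_frechet:
  fixes v :: "real \<Rightarrow> real \<Rightarrow> real"
  assumes "smooth_fun (\<lambda>(x, s). v x s)"
  shows "((\<lambda>t. v x t) has_real_derivative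
           frechet_derivative (\<lambda>(x, s). v x s) (at (x, s)) (0, 1)) (at s)"
proof -
  let ?f = "\<lambda>(x, s). v x s"
  let ?D = "frechet_derivative ?f (at (x, s))"
  have D: "(?f has_derivative ?D) (at (x, s))"
    using smooth_fun_differentiable[OF assms] frechet_derivative_works by blast
  have "((\<lambda>t. (x, t)) has_vector_derivative (0, 1)) (at s)"
    unfolding has_vector_derivative_def
    by (auto intro!: derivative_eq_intros)
  from vector_derivative_diff_chain_within[OF this has_derivative_at_withinI[OF D]]
  show ?thesis
    by (simp add: o_def has_real_derivative_iff_has_vector_derivative)
qed

lemma has_derivative_pdx:
  assumes "smooth_fun (\<lambda>(x, s). v x s)"
  shows "((\<lambda>y. v y s) has_real_derivative pdx v x s) (at x)"
  using partial_x_frechet[OF assms] DERIV_imp_deriv unfolding pdx_def by metis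

lemma has_derivative_pds:
  assumes "smooth_fun (\<lambda>(x, s). v x s)"
  shows "((\<lambda>t. v x t) has_real_derivative pds v x s) (at s)"
  using partial_s_frechet[OF assms] DERIV_imp_deriv unfolding pds_def by metis

lemma smooth_fun_pdx:
  assumes "smooth_fun (\<lambda>(x, s). v x s)"
  shows "smooth_fun (\<lambda>(x, s). pdx v x s)"
proof -
  have "(\<lambda>(x, s). pdx v x s) = (\<lambda>z. frechet_derivative (\<lambda>(x, s). v x s) (at z) (1, 0))"
    unfolding pdx_def by (auto intro!: ext DERIV_imp_deriv partial_x_frechet assms)
  then show ?thesis
    using smooth_fun_directional[OF assms] by simp
qed

lemma smooth_fun_pds:
  assumes "smooth_fun (\<lambda>(x, s). v x s)"
  shows "smooth_fun (\<lambda>(x, s). pds v x s)"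
proof -
  have "(\<lambda>(x, s). pds v x s) = (\<lambda>z. frechet_derivative (\<lambda>(x, s). v x s) (at z) (0, 1))"
    unfolding pds_def by (auto intro!: ext DERIV_imp_deriv partial_s_frechet assms)
  then show ?thesis
    using smooth_fun_directional[OF assms] by simp
qed

lemma continuous_on_slice:
  fixes v :: "real \<Rightarrow> real \<Rightarrow> real"
  assumes "continuous_on UNIV (\<lambda>(x, s). v x s)"
  shows "continuous_on S (v x)"
proof -
  have "continuous_on S (\<lambda>s. (\<lambda>(x, s). v x s) (x, s))"
    by (rule continuous_on_compose2[OF assms]) (auto intro!: continuous_intros)
  then show ?thesis by simp
qed

section \<open>Differentiation under the integral and mixed partial derivatives\<close>

lemma has_derivative_integral_parameter:
  fixes f g :: "real \<Rightarrow> real \<Rightarrow> real"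
  assumes "\<And>x t. ((\<lambda>y. f y t) has_real_derivative g x t) (at x)"
    and "\<And>x. continuous_on {a..b} (f x)"
    and "continuous_on UNIV (\<lambda>(x, t). g x t)"
  shows "((\<lambda>y. integral {a..b} (f y)) has_real_derivative integral {a..b} (g x)) (at x)"
proof -
  have "((\<lambda>y. integral (cbox a b) (f y)) has_real_derivative integral (cbox a b) (g x))
          (at x within UNIV)"
    by (rule leibniz_rule_field_derivative)
       (use assms in \<open>auto intro: integrable_continuous_real continuous_on_subset\<close>)
  then show ?thesis by simp
qed

text \<open>
  Writing \<open>v\<close> as \<open>v(y,a)\<close> plus the integral of \<open>v\<^sub>s\<close> over \<open>[a,t]\<close> and differentiating under the
  integral shows that \<open>v\<^sub>x(x,t)\<close> is \<open>v\<^sub>x(x,a)\<close> plus the integral of \<open>(v\<^sub>s)\<^sub>x\<close>; the fundamental theorem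
  of calculus then identifies its \<open>s\<close>-derivative as \<open>(v\<^sub>s)\<^sub>x\<close>.
\<close>
lemma pdx_pds_commute:
  assumes v: "smooth_fun (\<lambda>(x, s). v x s)"
  shows "pdx (pds v) = pds (pdx v)"
proof (intro ext)
  fix x s :: real
  \<comment> \<open>The base point lies below \<open>s\<close>, so that \<open>s\<close> is interior and one-sided derivatives are two-sided.\<close>
  define a b where "a = s - 1" and "b = s + 1"
  have s: "s \<in> {a<..<b}"
    by (simp add: a_def b_def)
  note vs = smooth_fun_pds[OF v]
  note vsx = smooth_fun_pdx[OF vs]
  have ftc: "integral {a..t} (pds v y) = v y t - v y a" if "a \<le> t" for y t
    by (intro integral_unique fundamental_theorem_of_calculus that
          has_derivative_pds[OF v, THEN has_field_derivative_at_within,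
            unfolded has_real_derivative_iff_has_vector_derivative])
  have vx: "pdx v x t = pdx v x a + integral {a..t} (pdx (pds v) x)" if "a \<le> t" for t
  proof -
    have "((\<lambda>y. integral {a..t} (pds v y)) has_real_derivative
             integral {a..t} (pdx (pds v) x)) (at x)"
      by (intro has_derivative_integral_parameter has_derivative_pdx vs
            continuous_on_slice smooth_fun_continuous vsx)
    then have "((\<lambda>y. v y t - v y a) has_real_derivative integral {a..t} (pdx (pds v) x)) (at x)"
      by (simp add: ftc[OF that])
    moreover have "((\<lambda>y. v y t - v y a) has_real_derivative pdx v x t - pdx v x a) (at x)"
      by (intro DERIV_diff has_derivative_pdx v)
    ultimately show ?thesis
      using DERIV_unique by fastforce
  qed
  have "((\<lambda>t. integral {a..t} (pdx (pds v) x)) has_real_derivative pdx (pds v) x s)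
          (at s within {a..b})"
    using s by (intro integral_has_real_derivative continuous_on_slice smooth_fun_continuous vsx) auto
  then have "((\<lambda>t. pdx v x a + integral {a..t} (pdx (pds v) x))
               has_real_derivative pdx (pds v) x s) (at s within {a..b})"
    by (auto intro!: derivative_eq_intros)
  then have "((\<lambda>t. pdx v x t) has_real_derivative pdx (pds v) x s) (at s within {a..b})"
    by (rule has_field_derivative_transform_within[OF _ zero_less_one]) (use s in \<open>auto simp flip: vx\<close>)
  then have "((\<lambda>t. pdx v x t) has_real_derivative pdx (pds v) x s) (at s)"
    using s by (simp add: at_within_Icc_at)
  then show "pdx (pds v) x s = pds (pdx v) x s"
    unfolding pds_def by (simp add: DERIV_imp_deriv)
qed

section \<open>The conservation law\<close>

theorem mainTheorem3:
  fixes \<sigma> :: real and V :: "real \<Rightarrow> real" and u :: "real \<Rightarrow> real \<Rightarrow> real"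
  assumes "smooth_fun V"
    and "smooth_fun (\<lambda>(x, s). u x s)"
  shows "(\<forall>x s. pds (lagrangian \<sigma> V u) x s
              + pds u x s * ((pdx ^^ 4) u x s + \<sigma> * (pdx ^^ 2) u x s + deriv V (u x s))
            = pdx (action_density \<sigma> u) x s)
       \<and> ((\<forall>s. solves_ode4 \<sigma> V (\<lambda>x. u x s)) \<longrightarrow>
            (\<forall>x s. pds (lagrangian \<sigma> V u) x s = pdx (action_density \<sigma> u) x s)
          \<and> (\<forall>T>0. (\<forall>x s. u x (s + T) = u x s) \<longrightarrow>
               (\<forall>x. ((\<lambda>y. integral {0..T} (\<lambda>s. action_density \<sigma> u y s))
                       has_real_derivative 0) (at x))))"
proof -
  define u1 u2 u3 u4 where "u1 = pdx u" and "u2 = pdx u1" and "u3 = pdx u2" and "u4 = pdx u3"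
  have pows: "(pdx ^^ 2) u = u2" "(pdx ^^ 3) u = u3" "(pdx ^^ 4) u = u4"
    by (simp_all add: numeral_eq_Suc u1_def u2_def u3_def u4_def)
  note s0 = assms(2)
  have s1: "smooth_fun (\<lambda>(x, s). u1 x s)"
    unfolding u1_def by (rule smooth_fun_pdx[OF s0])
  have s2: "smooth_fun (\<lambda>(x, s). u2 x s)"
    unfolding u2_def by (rule smooth_fun_pdx[OF s1])
  have s3: "smooth_fun (\<lambda>(x, s). u3 x s)"
    unfolding u3_def by (rule smooth_fun_pdx[OF s2])
  have s4: "smooth_fun (\<lambda>(x, s). u4 x s)"
    unfolding u4_def by (rule smooth_fun_pdx[OF s3])
  note smooth = s0 s1 s2 s3 s4
  have dx: "((\<lambda>y. u y s) has_real_derivative u1 x s) (at x)"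
    "((\<lambda>y. u1 y s) has_real_derivative u2 x s) (at x)"
    "((\<lambda>y. u2 y s) has_real_derivative u3 x s) (at x)"
    "((\<lambda>y. u3 y s) has_real_derivative u4 x s) (at x)"
    "((\<lambda>y. pds u y s) has_real_derivative pds u1 x s) (at x)"
    "((\<lambda>y. pds u2 y s) has_real_derivative pds u3 x s) (at x)" for x s
    using has_derivative_pdx[OF s0] has_derivative_pdx[OF s1]
      has_derivative_pdx[OF s2] has_derivative_pdx[OF s3]
      has_derivative_pdx[OF smooth_fun_pds[OF s0]] has_derivative_pdx[OF smooth_fun_pds[OF s2]]
    unfolding pdx_pds_commute[OF s0] pdx_pds_commute[OF s2]
    by (simp_all only: u1_def u2_def u3_def u4_def)
  define Ax where "Ax = (\<lambda>x s. u4 x s * pds u x s + u3 x s * pds u1 x s + u2 x s * pds u2 x s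
      + u1 x s * pds u3 x s + \<sigma> * (u2 x s * pds u x s + u1 x s * pds u1 x s))"
  define Ls where "Ls = (\<lambda>x s. pds u1 x s * u3 x s + u1 x s * pds u3 x s + u2 x s * pds u2 x s
      + \<sigma> * u1 x s * pds u1 x s - deriv V (u x s) * pds u x s)"
  have A: "action_density \<sigma> u = (\<lambda>x s. u3 x s * pds u x s + u1 x s * pds u2 x s
      + \<sigma> * u1 x s * pds u x s)"
    by (intro ext) (simp add: action_density_def pows u1_def)
  have L: "lagrangian \<sigma> V u = (\<lambda>x s. u1 x s * u3 x s + 1/2 * (u2 x s)\<^sup>2
      + 1/2 * \<sigma> * (u1 x s)\<^sup>2 - V (u x s))"
    by (intro ext) (simp add: lagrangian_def pows u1_def)
  have DA: "((\<lambda>y. action_density \<sigma> u y s) has_real_derivative Ax x s) (at x)" for x s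
    unfolding A Ax_def
    by (rule derivative_eq_intros dx refl)+ (simp add: algebra_simps)
  have DL: "((\<lambda>t. lagrangian \<sigma> V u x t) has_real_derivative Ls x s) (at s)" for x s
    unfolding L Ls_def
    by (rule derivative_eq_intros has_derivative_pds smooth refl
          DERIV_chain2[OF smooth_fun_has_deriv[OF assms(1)]])+
       (simp add: algebra_simps)
  have A_x: "pdx (action_density \<sigma> u) x s = Ax x s" for x s
    unfolding pdx_def using DA by (rule DERIV_imp_deriv)
  have L_s: "pds (lagrangian \<sigma> V u) x s = Ls x s" for x s
    unfolding pds_def using DL by (rule DERIV_imp_deriv)
  have identity: "Ls x s + pds u x s * (u4 x s + \<sigma> * u2 x s + deriv V (u x s)) = Ax x s" for x s
    by (simp add: Ls_def Ax_def algebra_simps)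
  have solves: "u4 x s + \<sigma> * u2 x s + deriv V (u x s) = 0"
    if "solves_ode4 \<sigma> V (\<lambda>x. u x s)" for x s
    using that by (simp add: solves_ode4_def numeral_eq_Suc u1_def u2_def u3_def u4_def pdx_def)
  have conserved: "((\<lambda>y. integral {0..T} (\<lambda>s. action_density \<sigma> u y s)) has_real_derivative 0) (at x)"
    if sol: "\<forall>s. solves_ode4 \<sigma> V (\<lambda>x. u x s)" and "T > 0" and per: "\<forall>x s. u x (s + T) = u x s"
    for T x
  proof -
    have cont: "continuous_on UNIV (\<lambda>(x, s). v x s)" "continuous_on UNIV (\<lambda>(x, s). pds v x s)"
      if "v \<in> {u, u1, u2, u3, u4}" for v
      using that smooth by (auto intro!: smooth_fun_continuous smooth_fun_pds)
    have contAx: "continuous_on UNIV (\<lambda>(x, s). Ax x s)"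
      using cont[of u] cont[of u1] cont[of u2] cont[of u3] cont[of u4]
      unfolding Ax_def split_beta by (auto intro!: continuous_intros)
    have "continuous_on UNIV (\<lambda>(x, s). action_density \<sigma> u x s)"
      using cont[of u] cont[of u1] cont[of u2] cont[of u3]
      unfolding A split_beta by (auto intro!: continuous_intros)
    then have contA: "continuous_on {0..T} (action_density \<sigma> u y)" for y
      by (rule continuous_on_slice)
    have "Ls y s = Ax y s" for y s
      using identity[of y s] solves[of s y] sol by simp
    then have "((\<lambda>t. lagrangian \<sigma> V u x t) has_vector_derivative Ax x s) (at s within {0..T})" for s
      using DL[of x s, THEN has_field_derivative_at_within]
      by (simp add: has_real_derivative_iff_has_vector_derivative)
    then have "(Ax x has_integral lagrangian \<sigma> V u x T - lagrangian \<sigma> V u x 0) {0..T}"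
      using \<open>T > 0\<close> by (intro fundamental_theorem_of_calculus) auto
    moreover have "lagrangian \<sigma> V u x T = lagrangian \<sigma> V u x 0"
    proof -
      have "u y T = u y 0" for y
        using per[rule_format, of y 0] by simp
      then show ?thesis
        by (simp add: L u1_def u2_def u3_def pdx_def)
    qed
    ultimately have "integral {0..T} (Ax x) = 0"
      by (simp add: integral_unique)
    then show ?thesis
      using has_derivative_integral_parameter[OF DA contA contAx, of x] by simp
  qed
  have "Ls x s = Ax x s" if "\<forall>s. solves_ode4 \<sigma> V (\<lambda>x. u x s)" for x s
    using identity[of x s] solves[of s x] that by simp
  then show ?thesis
    unfolding A_x L_s pows using identity conserved by blast
qed

end
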